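(* For every $n\in\mathbb{N}$, \[ \mathcal{M}^{(3)}(n)=\min_{1\le s\le t\le n}\mathcal{M}^{(3)}(n,s,t)=\Bigl\lfloor\frac{n^2-18n+101}{108}\Bigr\rfloor+\begin{cases}1,& n\equiv 36\pmod{54},\\ -1,& n\equiv 30 \text{ or } n\equiv 42\pmod{54},\\ 0,&\text{otherwise}.\end{cases} \]
   Context: For real $a>0$ and integers $1\le s\le t\le n$, $\mathcal{M}^{(a)}(n,s,t)$ is the number of ordered triples $T=(x,y,x+\lfloor ay\rfloor)\in\{1,\dots,n\}^3$ such that $T\in(\{1,\dots,s\}\cup\{t+1,\dots,n\})^3$ or $T\in\{s+1,\dots,t\}^3$ (monochromatic generalized Schur triples under the coloring $R^sB^{t-s}R^{n-t}$). For $a=3$ the triples are $(x,y,x+3y)$. *)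

theory Defs
  imports Complex_Main
begin

(* Red part of the colouring R^s B^(t-s) R^(n-t) on {1..n} *)
definition red_part :: "nat \<Rightarrow> nat \<Rightarrow> nat \<Rightarrow> int set" where
  "red_part n s t = {1..int s} \<union> {int t + 1..int n}"

definition blue_part :: "nat \<Rightarrow> nat \<Rightarrow> int set" where
  "blue_part s t = {int s + 1..int t}"

definition gen_schur_triples :: "real \<Rightarrow> nat \<Rightarrow> (int \<times> int \<times> int) set" where
  "gen_schur_triples a n =
     {(x, y, z). x \<in> {1..int n} \<and> y \<in> {1..int n} \<and> z \<in> {1..int n} \<and>
                 z = x + \<lfloor>a * real_of_int y\<rfloor>}"

definition schur_M :: "real \<Rightarrow> nat \<Rightarrow> nat \<Rightarrow> nat \<Rightarrow> nat" where
  "schur_M a n s t = card {(x, y, z) \<in> gen_schur_triples a n.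
      (x \<in> red_part n s t \<and> y \<in> red_part n s t \<and> z \<in> red_part n s t) \<or>
      (x \<in> blue_part s t \<and> y \<in> blue_part s t \<and> z \<in> blue_part s t)}"

definition schur_M_min :: "real \<Rightarrow> nat \<Rightarrow> nat" where
  "schur_M_min a n = Min {schur_M a n s t | s t. 1 \<le> s \<and> s \<le> t \<and> t \<le> n}"

end

theory Submission
  imports Defs
begin

text \<open>
  Write \<open>q m\<close> for the number \<open>tri_card m\<close> of pairs \<open>x, y \<ge> 1\<close> with \<open>x + 3 y \<le> m\<close>. If \<open>4 s \<le> t\<close> and
  \<open>n - t \<le> 3 s + 3\<close>, the monochromatic triples split into those inside the first red block, the
  blue ones, and those with only \<open>y\<close> in the first red block, so that their number is
  \<open>q u + q v + q w\<close> with \<open>u = s\<close>, \<open>v = t - 4 s\<close>, \<open>w = n - t\<close> and \<open>4 u + v + w = n\<close>.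
  Up to a term depending only on divisibility by 3, \<open>6 q m\<close> is \<open>m\<^sup>2 - 3 m\<close>, and
  Lagrange's identity \<open>18 (U\<^sup>2 + V\<^sup>2 + W\<^sup>2) = (4 U + V + W)\<^sup>2 + (U - 4 V)\<^sup>2 + (U - 4 W)\<^sup>2 + (V - W)\<^sup>2\<close>
  with \<open>U = u - 3/2\<close> and so on bounds this sum from below; the exceptional residues mod 54 come from the
  lattice points closest to the line \<open>U = 4 V = 4 W\<close>. For the other \<open>s, t\<close> a subset of the triples
  is already large enough, by quadratic inequalities. For the upper bound, adding \<open>54\<close> to \<open>n\<close>
  and \<open>(12, 3, 3)\<close> to \<open>(u, v, w)\<close> changes both sides by the same amount, which leaves one period to check.
\<close>

section \<open>Lattice points in triangles and truncated triangles\<close>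

definition triangle :: "int \<Rightarrow> (int \<times> int) set" where
  "triangle m = {(x, y). 1 \<le> x \<and> 1 \<le> y \<and> x + 3 * y \<le> m}"

definition strip :: "int \<Rightarrow> int \<Rightarrow> (int \<times> int) set" where
  "strip k m = {(x, y). 1 \<le> x \<and> 1 \<le> y \<and> y \<le> k \<and> x + 3 * y \<le> m}"

text \<open>For \<open>m \<ge> 0\<close> this is the size of \<open>triangle m\<close>. For negative
  \<open>m\<close> it is positive although the triangle is empty, hence the later
  \<open>max 0\<close>.\<close>

definition tri_card :: "int \<Rightarrow> int" where
  "tri_card m = (m - 1) * (m - 2) div 6"

definition min_value :: "int \<Rightarrow> int" where
  "min_value n = (n\<^sup>2 - 18 * n + 101) div 108 +
     (if n mod 54 = 36 then 1 else if n mod 54 = 30 \<or> n mod 54 = 42 then -1 else 0)"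

lemma finite_triangle: "finite (triangle m)"
proof (rule finite_subset)
  show "triangle m \<subseteq> {1..m} \<times> {1..m}" unfolding triangle_def by auto
qed simp

lemma finite_strip: "finite (strip k m)"
  by (rule finite_subset[OF _ finite_triangle[of m]]) (auto simp: strip_def triangle_def)

text \<open>Induction over rows: the new row \<open>y = k + 1\<close> has
  \<open>m - 3 * (k + 1)\<close> points, and \<open>3 * k \<le> m\<close> keeps all row lengths
  nonnegative.\<close>

lemma card_strip:
  assumes "0 \<le> k" "3 * k \<le> m"
  shows "2 * int (card (strip k m)) = 2 * k * m - 3 * k * (k + 1)"
  using assms
proof (induction k rule: int_ge_induct)
  case base
  have "strip 0 m = {}" by (auto simp: strip_def)
  then show ?case by simp
next
  case (step k)
  let ?R = "(\<lambda>x. (x, k + 1)) ` {1..m - 3 * (k + 1)}"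
  have eq: "strip (k + 1) m = strip k m \<union> ?R"
    using step by (auto simp: strip_def image_iff)
  have disj: "strip k m \<inter> ?R = {}"
    by (auto simp: strip_def)
  have "card ?R = nat (m - 3 * (k + 1))"
    by (subst card_image) (auto simp: inj_on_def)
  then have "int (card (strip (k + 1) m)) = int (card (strip k m)) + (m - 3 * (k + 1))"
    using step.prems unfolding eq by (subst card_Un_disjoint[OF finite_strip _ disj]) auto
  with step show ?case by (simp add: algebra_simps)
qed

text \<open>The product under \<open>div\<close> grows by a multiple of 6. With \<open>m\<close> in
  {0, 1, 2} this removes the floor; with large \<open>j\<close> it gives the periodicity used for
  the upper bound.\<close>

lemma tri_card_shift: "tri_card (3 * j + m) = tri_card m + 3 * (j * (j - 1) div 2) + j * m"
proof -
  define h where "h = j * (j - 1) div 2"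
  have "j * (j - 1) = 2 * h" unfolding h_def by simp
  then have "(3 * j + m - 1) * (3 * j + m - 2) = (m - 1) * (m - 2) + 6 * (3 * h + j * m)"
    by (simp add: algebra_simps)
  then show ?thesis unfolding tri_card_def h_def[symmetric] by simp
qed

lemma six_tri_card: "6 * tri_card m = m\<^sup>2 - 3 * m + (if 3 dvd m then 0 else 2)"
proof -
  define j r where "j = m div 3" and "r = m mod 3"
  have m: "m = 3 * j + r" unfolding j_def r_def by simp
  have r: "r = 0 \<or> r = 1 \<or> r = 2" unfolding r_def by presburger
  have d: "3 dvd m \<longleftrightarrow> r = 0" unfolding r_def by presburger
  have "2 * (j * (j - 1) div 2) = j * (j - 1)" by simp
  then have "6 * tri_card m = 6 * tri_card r + 9 * (j * (j - 1)) + 6 * (j * r)"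
    unfolding m tri_card_shift by simp
  moreover have "tri_card 0 = 0" "tri_card 1 = 0" "tri_card 2 = 0" by (simp_all add: tri_card_def)
  ultimately show ?thesis
    using r unfolding d unfolding m by (auto simp: algebra_simps power2_eq_square)
qed

text \<open>Since \<open>x \<ge> 1\<close>, a point has
  \<open>3 * y \<le> m - 1 < 3 * (k + 1)\<close>, so the cut at height \<open>k\<close> removes
  nothing.\<close>

lemma strip_eq_triangle: "m \<le> 3 * k + 3 \<Longrightarrow> strip k m = triangle m"
  by (auto simp: strip_def triangle_def)

lemma card_triangle:
  assumes "0 \<le> m"
  shows "int (card (triangle m)) = tri_card m"
proof -
  define j r where "j = m div 3" and "r = m mod 3"
  have j: "0 \<le> j" unfolding j_def using assms pos_imp_zdiv_nonneg_iff[of 3 m] by simp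
  have m: "m = 3 * j + r" unfolding j_def r_def by simp
  have r: "r = 0 \<or> r = 1 \<or> r = 2" unfolding r_def by presburger
  have d: "3 dvd m \<longleftrightarrow> r = 0" unfolding r_def by presburger
  have "triangle m = strip j m"
    using m r by (intro strip_eq_triangle[symmetric]) auto
  then have "2 * int (card (triangle m)) = 2 * j * m - 3 * j * (j + 1)"
    using card_strip[of j m] j m r by auto
  then have "6 * int (card (triangle m)) = 6 * tri_card m"
    unfolding six_tri_card using r unfolding d unfolding m
    by (auto simp: algebra_simps power2_eq_square)
  then show ?thesis by simp
qed

section \<open>Monochromatic triples as disjoint translated triangles and strips\<close>

definition mono_pairs :: "nat \<Rightarrow> nat \<Rightarrow> nat \<Rightarrow> (int \<times> int) set" where
  "mono_pairs n s t = {(x, y). 1 \<le> x \<and> 1 \<le> y \<and> x + 3 * y \<le> int n \<and>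
     ((x \<in> red_part n s t \<and> y \<in> red_part n s t \<and> x + 3 * y \<in> red_part n s t) \<or>
      (x \<in> blue_part s t \<and> y \<in> blue_part s t \<and> x + 3 * y \<in> blue_part s t))}"

lemma schur_M_eq_card: "schur_M 3 n s t = card (mono_pairs n s t)"
proof -
  have fl: "\<lfloor>(3::real) * real_of_int y\<rfloor> = 3 * y" for y
  proof -
    have "(3::real) * real_of_int y = real_of_int (3 * y)" by simp
    then show ?thesis by (simp only: floor_of_int)
  qed
  have "{(x, y, z) \<in> gen_schur_triples 3 n.
      (x \<in> red_part n s t \<and> y \<in> red_part n s t \<and> z \<in> red_part n s t) \<or>
      (x \<in> blue_part s t \<and> y \<in> blue_part s t \<and> z \<in> blue_part s t)}
      = (\<lambda>(x, y). (x, y, x + 3 * y)) ` mono_pairs n s t"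
    unfolding gen_schur_triples_def mono_pairs_def fl by (auto simp: image_iff)
  moreover have "inj_on (\<lambda>(x, y). (x, y, x + 3 * y)) (mono_pairs n s t)"
    by (auto simp: inj_on_def)
  ultimately show ?thesis unfolding schur_M_def by (simp add: card_image)
qed

lemma finite_mono_pairs: "finite (mono_pairs n s t)"
  by (rule finite_subset[OF _ finite_triangle[of "int n"]]) (auto simp: mono_pairs_def triangle_def)

lemma mem_triangle: "(x, y) \<in> triangle m \<longleftrightarrow> 1 \<le> x \<and> 1 \<le> y \<and> x + 3 * y \<le> m"
  by (simp add: triangle_def)

definition translate :: "int \<Rightarrow> int \<Rightarrow> int \<times> int \<Rightarrow> int \<times> int" where
  "translate a b p = (fst p + a, snd p + b)"

lemma card_translate: "card (translate a b ` A) = card A"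
  by (rule card_image) (auto simp: inj_on_def translate_def prod_eq_iff)

lemma mem_translate_triangle:
  "(x, y) \<in> translate a b ` triangle m \<longleftrightarrow> a < x \<and> b < y \<and> (x - a) + 3 * (y - b) \<le> m"
proof
  assume "a < x \<and> b < y \<and> (x - a) + 3 * (y - b) \<le> m"
  then have "(x - a, y - b) \<in> triangle m" by (auto simp: triangle_def)
  then show "(x, y) \<in> translate a b ` triangle m"
    by (rule rev_image_eqI) (simp add: translate_def)
qed (auto simp: translate_def triangle_def)

lemma mem_translate_strip:
  "(x, y) \<in> translate a b ` strip k m \<longleftrightarrow>
     a < x \<and> b < y \<and> y \<le> k + b \<and> (x - a) + 3 * (y - b) \<le> m"
proof
  assume "a < x \<and> b < y \<and> y \<le> k + b \<and> (x - a) + 3 * (y - b) \<le> m"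
  then have "(x - a, y - b) \<in> strip k m" by (auto simp: strip_def)
  then show "(x, y) \<in> translate a b ` strip k m"
    by (rule rev_image_eqI) (simp add: translate_def)
qed (auto simp: translate_def strip_def)

text \<open>The four families are: all entries in the first red block; all blue; only
  \<open>y\<close> in the first red block; all in the last red block. Red triples with
  \<open>x \<le> s\<close> and \<open>z > t\<close> are left out.\<close>

lemma schur_M_lower:
  assumes "s \<le> t" "t \<le> n"
  shows "card (triangle (int s)) + card (triangle (int t - 4 * int s))
       + card (strip (int s) (int n - int t)) + card (triangle (int n - 4 * int t))
       \<le> schur_M 3 n s t"
proof -
  let ?A = "triangle (int s)"
  let ?B = "translate (int s) (int s) ` triangle (int t - 4 * int s)"
  let ?C = "translate (int t) 0 ` strip (int s) (int n - int t)"
  let ?D = "translate (int t) (int t) ` triangle (int n - 4 * int t)"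
  have fin: "finite ?A" "finite ?B" "finite ?C" "finite ?D"
    by (simp_all add: finite_triangle finite_strip)
  have AB: "?A \<inter> ?B = {}"
    unfolding disjoint_iff split_paired_All
    using assms by (simp add: mem_translate_triangle mem_triangle)
  have ABC: "(?A \<union> ?B) \<inter> ?C = {}"
    unfolding disjoint_iff split_paired_All
    using assms by (simp add: mem_translate_triangle mem_translate_strip mem_triangle)
  have ABCD: "(?A \<union> ?B \<union> ?C) \<inter> ?D = {}"
    unfolding disjoint_iff split_paired_All
    using assms by (simp add: mem_translate_triangle mem_translate_strip mem_triangle)
  have "card (?A \<union> ?B \<union> ?C \<union> ?D) = card ?A + card ?B + card ?C + card ?D"
    using fin AB ABC ABCD by (simp add: card_Un_disjoint)
  moreover have "?A \<union> ?B \<union> ?C \<union> ?D \<subseteq> mono_pairs n s t"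
  proof
    fix p assume p: "p \<in> ?A \<union> ?B \<union> ?C \<union> ?D"
    obtain x y where "p = (x, y)" by (cases p)
    with p assms show "p \<in> mono_pairs n s t"
      by (auto simp: mem_translate_triangle mem_translate_strip mem_triangle
          mono_pairs_def red_part_def blue_part_def)
  qed
  ultimately show ?thesis
    using card_mono[OF finite_mono_pairs] unfolding schur_M_eq_card card_translate by metis
qed

text \<open>No red triple has \<open>y > t\<close>, since then
  \<open>x + 3 * y \<ge> 3 * t + 4 > n\<close>; and \<open>x, y \<le> s\<close> forces
  \<open>x + 3 * y \<le> 4 * s \<le> t\<close>, so it cannot end in the last red block.\<close>

lemma schur_M_upper:
  assumes "4 * s \<le> t" "t \<le> n" "n \<le> 3 * t + 3"
  shows "int (schur_M 3 n s t) \<le> tri_card (int s) + tri_card (int t - 4 * int s) + tri_card (int n - int t)"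
proof -
  let ?A = "triangle (int s)"
  let ?B = "translate (int s) (int s) ` triangle (int t - 4 * int s)"
  let ?C = "translate (int t) 0 ` triangle (int n - int t)"
  have "mono_pairs n s t \<subseteq> ?A \<union> ?B \<union> ?C"
  proof
    fix p assume p: "p \<in> mono_pairs n s t"
    obtain x y where "p = (x, y)" by (cases p)
    with p assms show "p \<in> ?A \<union> ?B \<union> ?C"
      by (auto simp: mem_translate_triangle mem_triangle
          mono_pairs_def red_part_def blue_part_def)
  qed
  then have "card (mono_pairs n s t) \<le> card (?A \<union> ?B \<union> ?C)"
    by (intro card_mono) (simp_all add: finite_triangle)
  also have "\<dots> \<le> card ?A + card ?B + card ?C"
    by (meson card_Un_le add_mono le_refl order_trans)
  finally have "schur_M 3 n s t \<le> card (triangle (int s)) +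
      card (triangle (int t - 4 * int s)) + card (triangle (int n - int t))"
    unfolding schur_M_eq_card card_translate .
  then have "int (schur_M 3 n s t) \<le> int (card (triangle (int s))) +
      int (card (triangle (int t - 4 * int s))) + int (card (triangle (int n - int t)))"
    by linarith
  then show ?thesis using assms by (simp add: card_triangle)
qed

section \<open>Quasi-periodicity of the closed form modulo 54\<close>

lemma min_value_shift:
  "min_value (54 * k + r) = min_value r + 27 * k\<^sup>2 - 9 * k + k * r"
proof -
  have "(54 * k + r)\<^sup>2 - 18 * (54 * k + r) + 101
      = (r\<^sup>2 - 18 * r + 101) + 108 * (27 * k\<^sup>2 - 9 * k + k * r)"
    by (simp add: power2_eq_square algebra_simps)
  then show ?thesis unfolding min_value_def by simp
qed

text \<open>The slack allowed here, compared with the floor expression, is exactly what remains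
  for the worst residue \<open>n \<equiv> 36\<close>.\<close>

lemma min_value_le:
  assumes "108 * S > n\<^sup>2 - 18 * n"
  shows "min_value n \<le> S"
proof (cases "n mod 54 = 36")
  case True
  define k where "k = n div 54"
  have n: "n = 54 * k + 36" unfolding k_def using True by presburger
  have "min_value 36 = 7" by (simp add: min_value_def)
  then have "min_value n = 7 + 27 * k\<^sup>2 + 27 * k" unfolding n min_value_shift by simp
  \<comment> \<open>Here \<open>n\<^sup>2 - 18 * n\<close> is itself a multiple of 108, so the
    strict inequality gains a whole unit, which pays for the correction +1.\<close>
  moreover have "n\<^sup>2 - 18 * n = 108 * (6 + 27 * k\<^sup>2 + 27 * k)"
    unfolding n by (simp add: power2_eq_square algebra_simps)
  ultimately show ?thesis using assms by simp
next
  case False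
  then have "min_value n \<le> (n\<^sup>2 - 18 * n + 101) div 108" by (simp add: min_value_def)
  also have "\<dots> \<le> S" using assms by linarith
  finally show ?thesis .
qed

section \<open>The sharp lower bound for three triangle counts\<close>

text \<open>Lagrange's identity times 4 to clear the halves; 486 is 72 times 27/4, from completing
  three squares.\<close>

lemma sum_squares_identity:
  fixes u v w :: int
  shows "4 * 18 * (u\<^sup>2 - 3 * u + (v\<^sup>2 - 3 * v) + (w\<^sup>2 - 3 * w)) =
     4 * (4 * u + v + w - 9)\<^sup>2 - 486 + (2 * (u - 4 * v) + 9)\<^sup>2 + (2 * (u - 4 * w) + 9)\<^sup>2 + 4 * (v - w)\<^sup>2"
  by (simp add: power2_eq_square algebra_simps)

text \<open>The number \<open>c\<close> of arguments not divisible by 3 decides: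
  \<open>c \<ge> 2\<close> covers even the worst residue, \<open>c = 1\<close> suffices for the
  floor, and \<open>c = 0\<close> needs the squares in Lagrange's identity.\<close>

lemma min_value_le_sum_tri_card: "min_value (4 * u + v + w) \<le> tri_card u + tri_card v + tri_card w"
proof -
  define n where "n = 4 * u + v + w"
  define S where "S = tri_card u + tri_card v + tri_card w"
  define c :: int where "c = (if 3 dvd u then 0 else 1) + (if 3 dvd v then 0 else 1) + (if 3 dvd w then 0 else 1)"
  have "6 * S = u\<^sup>2 - 3 * u + (v\<^sup>2 - 3 * v) + (w\<^sup>2 - 3 * w) + 2 * c"
    unfolding S_def c_def using six_tri_card[of u] six_tri_card[of v] six_tri_card[of w] by (auto split: if_splits)
  then have S: "432 * S = 4 * (n - 9)\<^sup>2 - 486 + (2 * (u - 4 * v) + 9)\<^sup>2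
      + (2 * (u - 4 * w) + 9)\<^sup>2 + 4 * (v - w)\<^sup>2 + 144 * c"
    using sum_squares_identity[of u v w] unfolding n_def by (simp add: algebra_simps)
  have n9: "(n - 9)\<^sup>2 = n\<^sup>2 - 18 * n + 81" by (simp add: power2_eq_square algebra_simps)
  have "min_value n \<le> S"
  proof (cases "c = 0")
    case False
    show ?thesis
    proof (cases "c \<ge> 2")
      case True
      have "0 \<le> (2 * (u - 4 * v) + 9)\<^sup>2" "0 \<le> (2 * (u - 4 * w) + 9)\<^sup>2" "0 \<le> (v - w)\<^sup>2" by auto
      with S n9 True have "108 * S > n\<^sup>2 - 18 * n" by linarith
      then show ?thesis by (rule min_value_le)
    next
      case c: False
      with False have c1: "c = 1" unfolding c_def by (auto split: if_splits)
      \<comment> \<open>Exactly one of \<open>u\<close>, \<open>v\<close>, \<open>w\<close> is not a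
        multiple of 3, so \<open>n\<close> is not one either; this excludes the residue 36.\<close>
      then have "\<not> 3 dvd n" unfolding c_def n_def by (auto split: if_splits) presburger+
      then have "n mod 54 \<noteq> 36" by presburger
      then have "min_value n \<le> (n\<^sup>2 - 18 * n + 101) div 108" by (simp add: min_value_def)
      moreover have "0 \<le> (2 * (u - 4 * v) + 9)\<^sup>2" "0 \<le> (2 * (u - 4 * w) + 9)\<^sup>2" "0 \<le> (v - w)\<^sup>2" by auto
      then have "108 * S > n\<^sup>2 - 18 * n + 101 - 108" using S n9 c1 by linarith
      ultimately show ?thesis by linarith
    qed
  next
    case True
    then have "3 dvd u" "3 dvd v" "3 dvd w" unfolding c_def by (auto split: if_splits)
    then obtain u' v' w' where uvw: "u = 3 * u'" "v = 3 * v'" "w = 3 * w'" by (auto elim!: dvdE)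
    define a d where "a = u' - 4 * v'" and "d = v' - w'"
    have "(2 * (u - 4 * v) + 9)\<^sup>2 + (2 * (u - 4 * w) + 9)\<^sup>2 + 4 * (v - w)\<^sup>2
       = 9 * ((2 * a + 3)\<^sup>2 + (2 * a + 3 + 8 * d)\<^sup>2 + 4 * d\<^sup>2)"
      unfolding uvw a_def d_def by (simp add: power2_eq_square algebra_simps)
    also have "(2 * a + 3)\<^sup>2 + (2 * a + 3 + 8 * d)\<^sup>2 = 2 * (2 * a + 3 + 4 * d)\<^sup>2 + 32 * d\<^sup>2"
      by (simp add: power2_eq_square algebra_simps)
    finally have S': "432 * S = 4 * (n - 9)\<^sup>2 - 486 + 18 * (2 * a + 3 + 4 * d)\<^sup>2 + 324 * d\<^sup>2"
      using S True by simp
    show ?thesis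
    proof (cases "d = 0")
      case False
      then have "d\<^sup>2 \<ge> 1" by (simp add: int_one_le_iff_zero_less)
      moreover have "0 \<le> (2 * a + 3 + 4 * d)\<^sup>2" by simp
      ultimately have "108 * S > n\<^sup>2 - 18 * n" using S' n9 by linarith
      then show ?thesis by (rule min_value_le)
    next
      case True
      have n: "n = 54 * v' + 12 * a"
        using True unfolding n_def uvw a_def d_def by simp
      have S4: "108 * S = (n - 9)\<^sup>2 - 117 + 18 * (a * (a + 3)) + 36"
        using S' True by (simp add: power2_eq_square algebra_simps)
      consider "a = -1 \<or> a = -2" | "a = 0 \<or> a = -3" | "a \<ge> 1 \<or> a \<le> -4" by linarith
      then show ?thesis
      proof cases
        case 1
        \<comment> \<open>-12 and -24 represent the residues 42 and 30: only here does
          \<open>a * (a + 3)\<close> become negative, which accounts for the correction -1.\<close>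
        have "min_value (-12) = 3" "min_value (-24) = 9" by (simp_all add: min_value_def)
        then show ?thesis
          using 1 S4 min_value_shift[of v' "-12"] min_value_shift[of v' "-24"]
          unfolding n by (auto simp: power2_eq_square algebra_simps)
      next
        case 2
        \<comment> \<open>Here \<open>a * (a + 3) = 0\<close> and \<open>n\<close> has residue 0 or
          18, where the floor alone is met with equality.\<close>
        have "min_value 0 = 0" "min_value (-36) = 18" by (simp_all add: min_value_def)
        then show ?thesis
          using 2 S4 min_value_shift[of v' "0"] min_value_shift[of v' "-36"]
          unfolding n by (auto simp: power2_eq_square algebra_simps)
      next
        case 3
        then have "a * (a + 3) \<ge> 4"
        proof
          assume "a \<ge> 1"
          then show ?thesis using mult_mono[of 1 a 4 "a + 3"] by simp
        next
          assume "a \<le> -4"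
          then show ?thesis using mult_mono[of 4 "-a" 1 "-(a + 3)"] by (simp add: algebra_simps)
        qed
        then have "108 * S > n\<^sup>2 - 18 * n" using S4 n9 by linarith
        then show ?thesis by (rule min_value_le)
      qed
    qed
  qed
  then show ?thesis unfolding n_def S_def .
qed

section \<open>Small \<open>n\<close>, and quadratic inequalities away from the sharp range\<close>

lemma min_value_eq_0:
  assumes "1 \<le> n" "n \<le> 18"
  shows "min_value n = 0"
proof -
  have "(n - 1) * (n - 18) \<le> 0" using assms by (simp add: mult_nonneg_nonpos)
  then have "n\<^sup>2 - 18 * n + 101 < 108"
    using assms by (simp add: power2_eq_square algebra_simps)
  moreover have "(n - 9)\<^sup>2 = n\<^sup>2 - 18 * n + 81"
    by (simp add: power2_eq_square algebra_simps)
  then have "0 \<le> n\<^sup>2 - 18 * n + 101" using zero_le_power2[of "n - 9"] by linarith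
  ultimately show ?thesis using assms by (simp add: min_value_def)
qed

lemma square_minus_18_mono:
  fixes n N :: int
  assumes "9 \<le> n" "n \<le> N"
  shows "n\<^sup>2 - 18 * n \<le> N\<^sup>2 - 18 * N"
proof -
  have "0 \<le> (N - n) * (N + n - 18)" using assms by simp
  then show ?thesis by (simp add: power2_eq_square algebra_simps)
qed


text \<open>The last hypothesis says that \<open>E\<close> is linear interpolation of the end values
  plus \<open>(w - w0) * (w1 - w)\<close>, multiplied by \<open>w1 - w0\<close> to avoid division: a
  quadratic in \<open>w\<close> with leading coefficient -1.\<close>

lemma int_interval_concave:
  fixes E0 E1 E :: int
  assumes "w0 \<le> w" "w \<le> w1" "w0 < w1" "0 < E0" "0 < E1"
    and "(w1 - w0) * E = (w1 - w) * E0 + (w - w0) * E1 + (w1 - w0) * (w - w0) * (w1 - w)"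
  shows "0 < E"
proof -
  have nonneg: "0 \<le> (w1 - w) * E0" "0 \<le> (w - w0) * E1" "0 \<le> (w1 - w0) * (w - w0) * (w1 - w)"
    using assms by simp_all
  have "0 < (w1 - w) * E0 \<or> 0 < (w - w0) * E1"
    using assms by (cases "w = w1") auto
  with nonneg have "0 < (w1 - w0) * E" unfolding assms(6) by linarith
  with assms(3) show ?thesis by (simp add: zero_less_mult_iff)
qed

text \<open>The two red triangles of sizes \<open>s\<close> and \<open>w\<close> suffice. Strictness
  of \<open>t < 4 * s\<close> gives \<open>n \<le> 4 * s + w - 1\<close>, and monotonicity allows
  this value in place of \<open>n\<close>.\<close>

lemma small_t_bound:
  fixes s t n w :: int
  assumes "n \<ge> 19" "t < 4 * s" "n = t + w" "0 \<le> w" "w \<le> 3 * s + 3"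
  shows "18 * (s\<^sup>2 - 3 * s + (w\<^sup>2 - 3 * w)) > n\<^sup>2 - 18 * n"
proof -
  have "n\<^sup>2 - 18 * n \<le> (4 * s + w - 1)\<^sup>2 - 18 * (4 * s + w - 1)"
    using assms by (intro square_minus_18_mono) auto
  \<comment> \<open>From \<open>19 \<le> n \<le> 7 * s + 2\<close>.\<close>
  moreover have "s \<ge> 3" using assms by linarith
  moreover have "9 * w\<^sup>2 - 34 * w \<ge> -34"
  proof (cases "w \<ge> 4")
    case True
    then have "4 * w \<le> w * w" by (intro mult_right_mono) auto
    then show ?thesis using True unfolding power2_eq_square by linarith
  next
    case False
    with assms consider "w = 0" | "w = 1" | "w = 2" | "w = 3" by linarith
    then show ?thesis by cases auto
  qed
  moreover have "18 * (s\<^sup>2 - 3 * s + (w\<^sup>2 - 3 * w)) - ((4 * s + w - 1)\<^sup>2 - 18 * (4 * s + w - 1))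
      = 2 * (s - 2 * w)\<^sup>2 + (9 * w\<^sup>2 - 34 * w) + 26 * s - 19"
    by (simp add: power2_eq_square algebra_simps)
  moreover have "0 \<le> (s - 2 * w)\<^sup>2" by simp
  ultimately show ?thesis by linarith
qed

text \<open>The left side is 18 times a lower bound for six times the points in the triangles of
  sizes \<open>s\<close> and \<open>v\<close> and the strip of height \<open>s\<close>. The upper
  limit on \<open>w\<close> encodes \<open>n \<le> 4 * t\<close>.\<close>

lemma middle_bound:
  fixes s t n v w :: int
  assumes "n \<ge> 9" "1 \<le> s" "0 \<le> v" "n \<le> 4 * s + v + w" "3 * s \<le> w" "w \<le> 12 * s + 3 * v"
  shows "18 * (v\<^sup>2 - 3 * v - 8 * s\<^sup>2 + 6 * s * w - 12 * s) > n\<^sup>2 - 18 * n"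
proof -
  define E where "E = 18 * (v\<^sup>2 - 3 * v - 8 * s\<^sup>2 + 6 * s * w - 12 * s)
     - ((4 * s + v + w)\<^sup>2 - 18 * (4 * s + v + w))"
  \<comment> \<open>The difference of the two sides at \<open>n = 4 s + v + w\<close> is concave in \<open>w\<close>; \<open>E0\<close> and \<open>E1\<close> are its
    values at the endpoints \<open>w = 3 s\<close> and \<open>w = 12 s + 3 v\<close>.\<close>
  define E0 where "E0 = 7 * (v - s)\<^sup>2 + (10 * v\<^sup>2 - 36 * v) + (124 * s\<^sup>2 - 90 * s)"
  define E1 where "E1 = 2 * v\<^sup>2 + 896 * s\<^sup>2 + 196 * s * v + 72 * s + 18 * v"
  have "s * 1 \<le> s * s" using assms by (intro mult_left_mono) auto
  then have s2: "s \<le> s\<^sup>2" by (simp add: power2_eq_square)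
  have "10 * v\<^sup>2 - 36 * v \<ge> -33"
  proof (cases "v \<ge> 4")
    case True
    then have "4 * v \<le> v * v" by (intro mult_right_mono) auto
    then show ?thesis using True unfolding power2_eq_square by linarith
  next
    case False
    with assms consider "v = 0" | "v = 1" | "v = 2" | "v = 3" by linarith
    then show ?thesis by cases auto
  qed
  moreover have "0 \<le> (v - s)\<^sup>2" by simp
  ultimately have "0 < E0" unfolding E0_def using s2 assms by linarith
  moreover have "0 \<le> v\<^sup>2" "0 \<le> s * v" using assms by auto
  then have "0 < E1" unfolding E1_def using s2 assms by linarith
  ultimately have "0 < E"
  proof (rule int_interval_concave[where ?w0.0 = "3 * s" and ?w1.0 = "12 * s + 3 * v" and w = w, rotated 3])
    show "(12 * s + 3 * v - 3 * s) * E = (12 * s + 3 * v - w) * E0 + (w - 3 * s) * E1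
       + (12 * s + 3 * v - 3 * s) * (w - 3 * s) * (12 * s + 3 * v - w)"
      unfolding E_def E0_def E1_def by (simp add: power2_eq_square algebra_simps)
  qed (use assms in auto)
  moreover have "n\<^sup>2 - 18 * n \<le> (4 * s + v + w)\<^sup>2 - 18 * (4 * s + v + w)"
    using assms by (intro square_minus_18_mono) auto
  ultimately show ?thesis unfolding E_def by linarith
qed

text \<open>For \<open>n > 4 * t\<close> the triangle of size \<open>m\<close> in the last red block
  is added. In each case the difference of the two sides is written as a sum of nonnegative terms,
  one of them positive.\<close>

lemma large_n_bound:
  fixes s t n v m :: int
  assumes "1 \<le> s" "s \<le> t" "1 \<le> m" "n = m + 4 * t" "v = max 0 (t - 4 * s)"
  shows "18 * (v\<^sup>2 - 3 * v - 8 * s\<^sup>2 + 6 * s * (n - t) - 12 * s + (m\<^sup>2 - 3 * m)) > n\<^sup>2 - 18 * n"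
proof (cases "t \<ge> 4 * s")
  case True
  then have t: "t = 4 * s + v" and v: "0 \<le> v" using assms by auto
  have "18 * (v\<^sup>2 - 3 * v - 8 * s\<^sup>2 + 6 * s * (n - t) - 12 * s + (m\<^sup>2 - 3 * m)) - (n\<^sup>2 - 18 * n)
     = 2 * (v - 2 * m)\<^sup>2 + 9 * m\<^sup>2 + 18 * v + 896 * s\<^sup>2 + 40 * (s * m) + 36 * ((s - 1) * m) + 196 * (s * v) + 72 * s"
    unfolding assms(4) t by (simp add: power2_eq_square algebra_simps)
  moreover have "0 \<le> (v - 2 * m)\<^sup>2" "0 \<le> m\<^sup>2" "0 \<le> s\<^sup>2" "0 \<le> s * m" "0 \<le> (s - 1) * m" "0 \<le> s * v"
    using assms v by auto
  ultimately show ?thesis using assms v by linarith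
next
  case False
  define e where "e = t - s"
  have t: "t = s + e" and e: "0 \<le> e" "0 \<le> 3 * s - e" and v: "v = 0"
    using False assms unfolding e_def by auto
  have "18 * (v\<^sup>2 - 3 * v - 8 * s\<^sup>2 + 6 * s * (n - t) - 12 * s + (m\<^sup>2 - 3 * m)) - (n\<^sup>2 - 18 * n)
     = 17 * m\<^sup>2 + 8 * (m * (3 * s - e)) + 40 * (m * s) + 36 * (m * (s - 1)) + 144 * (s * (s - 1)) + 20 * s\<^sup>2
       + 16 * (e * (3 * s - e)) + 244 * (s * e) + 72 * e"
    unfolding assms(4) t v by (simp add: power2_eq_square algebra_simps)
  moreover have "0 \<le> m\<^sup>2" "0 \<le> m * (3 * s - e)" "0 < m * s" "0 \<le> m * (s - 1)" "0 \<le> s * (s - 1)"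
     "0 \<le> s\<^sup>2" "0 \<le> e * (3 * s - e)" "0 \<le> s * e"
    using assms e by auto
  ultimately show ?thesis using e by linarith
qed

lemma six_tri_card_ge: "6 * tri_card m \<ge> m\<^sup>2 - 3 * m"
  unfolding six_tri_card by simp

lemma tri_card_nonneg: "0 \<le> m \<Longrightarrow> 0 \<le> tri_card m"
  using card_triangle[of m] by linarith

section \<open>The lower bound for all \<open>s\<close> and \<open>t\<close>\<close>

text \<open>If \<open>n - t \<le> 3 * s + 3\<close>, the strip is a full triangle, and the sharp
  bound or \<open>small_t_bound\<close> applies according to whether \<open>4 * s \<le> t\<close>.
  Otherwise the strip is truncated, and \<open>n \<le> 4 * t\<close> separates the two remaining
  estimates.\<close>

lemma min_value_le_count:
  fixes s t n :: int
  assumes "1 \<le> s" "s \<le> t" "t \<le> n" "1 \<le> n"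
  shows "min_value n \<le> tri_card s + tri_card (max 0 (t - 4 * s)) + int (card (strip s (n - t))) + tri_card (max 0 (n - 4 * t))"
proof (cases "n \<le> 18")
  case True
  then have "min_value n = 0" using assms by (intro min_value_eq_0) auto
  then show ?thesis using assms by (simp add: tri_card_nonneg)
next
  case False
  define w where "w = n - t"
  define v where "v = max 0 (t - 4 * s)"
  define m where "m = max 0 (n - 4 * t)"
  define c where "c = int (card (strip s w))"
  have nonneg: "0 \<le> w" "0 \<le> v" "0 \<le> m" unfolding w_def v_def m_def using assms by auto
  have q0: "0 \<le> tri_card v" "0 \<le> tri_card m" using nonneg tri_card_nonneg by auto
  have "min_value n \<le> tri_card s + tri_card v + c + tri_card m"
  proof (cases "w \<le> 3 * s + 3")
    case True
    then have c: "c = tri_card w"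
      unfolding c_def using nonneg by (simp add: strip_eq_triangle card_triangle)
    show ?thesis
    proof (cases "4 * s \<le> t")
      case True
      then have "n = 4 * s + v + w" unfolding w_def v_def by simp
      then show ?thesis using min_value_le_sum_tri_card[of s v w] c q0 by simp
    next
      case t: False
      have "n\<^sup>2 - 18 * n < 18 * (s\<^sup>2 - 3 * s + (w\<^sup>2 - 3 * w))"
        using False t True nonneg by (intro small_t_bound[of _ t]) (auto simp: w_def)
      then have "108 * (tri_card s + tri_card w) > n\<^sup>2 - 18 * n"
        using six_tri_card_ge[of s] six_tri_card_ge[of w] unfolding ring_distribs by linarith
      then have "min_value n \<le> tri_card s + tri_card w" by (rule min_value_le)
      then show ?thesis using c q0 by linarith
    qed
  next
    case w: False
    have "2 * c = 2 * s * w - 3 * s * (s + 1)"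
      unfolding c_def using w assms by (intro card_strip) auto
    then have c: "6 * c = 6 * s * w - 9 * s\<^sup>2 - 9 * s"
      by (simp add: power2_eq_square algebra_simps)
    have "108 * (tri_card s + tri_card v + c + tri_card m) > n\<^sup>2 - 18 * n"
    proof (cases "n \<le> 4 * t")
      case True
      have "t \<le> 4 * s + v" unfolding v_def by simp
      then have "18 * (v\<^sup>2 - 3 * v - 8 * s\<^sup>2 + 6 * s * w - 12 * s) > n\<^sup>2 - 18 * n"
        using False w True assms nonneg unfolding w_def by (intro middle_bound) linarith+
      then show ?thesis
        using c six_tri_card_ge[of s] six_tri_card_ge[of v] q0 unfolding ring_distribs by linarith
    next
      case n: False
      then have m: "1 \<le> m" "n = m + 4 * t" unfolding m_def by simp_all
      have "18 * (v\<^sup>2 - 3 * v - 8 * s\<^sup>2 + 6 * s * w - 12 * s + (m\<^sup>2 - 3 * m)) > n\<^sup>2 - 18 * n"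
        unfolding w_def by (rule large_n_bound[OF assms(1,2) m v_def])
      then show ?thesis
        using c six_tri_card_ge[of s] six_tri_card_ge[of v] six_tri_card_ge[of m] unfolding ring_distribs by linarith
    qed
    then show ?thesis by (rule min_value_le)
  qed
  then show ?thesis unfolding c_def v_def m_def w_def .
qed

lemma min_value_le_schur_M:
  assumes "1 \<le> s" "s \<le> t" "t \<le> n"
  shows "min_value (int n) \<le> int (schur_M 3 n s t)"
proof -
  have T: "tri_card (max 0 k) \<le> int (card (triangle k))" for k
    by (cases "0 \<le> k") (auto simp: card_triangle tri_card_def)
  show ?thesis
    using schur_M_lower[OF assms(2,3)] T[of "int t - 4 * int s"] T[of "int n - 4 * int t"]
      card_triangle[of "int s"] min_value_le_count[of "int s" "int t" "int n"] assms
    by linarith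
qed

section \<open>Colourings that attain the minimum\<close>

text \<open>The choice of \<open>\<alpha>\<close> was found by computer search for minimisers with \<open>v = 3\<close>; the period starts at 16
  because at 15 this choice of \<open>\<alpha>\<close> is not optimal.\<close>

lemma sum_tri_card_eq_min_value:
  assumes "16 \<le> r" "r \<le> 69"
  shows "let \<alpha> = (if r \<le> 43 then r - 4 else r - 6) div 4
         in tri_card \<alpha> + tri_card 3 + tri_card (r - 4 * \<alpha> - 3) = min_value r"
proof -
  \<comment> \<open>As an explicit list, the 54 residues can be evaluated one by one.\<close>
  have r: "r \<in> set [16..69]" using assms by (simp only: set_upto atLeastAtMost_iff)
  have "\<forall>r \<in> set [16..69]. let \<alpha> = (if r \<le> 43 then r - 4 else r - 6) div 4
         in tri_card \<alpha> + tri_card 3 + tri_card (r - 4 * \<alpha> - 3) = min_value r"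
    by (simp add: upto_rec_numeral tri_card_def min_value_def)
  then show ?thesis using r by (rule bspec)
qed

text \<open>For \<open>n \<le> 3\<close> no triple exists; for \<open>n \<le> 15\<close> three
  triangles of size at most 3 are empty; from 16 on, the colouring for one period is shifted by
  \<open>k\<close> periods.\<close>

lemma schur_M_le_min_value:
  assumes "1 \<le> n"
  obtains s t where "1 \<le> s" "s \<le> t" "t \<le> n" "int (schur_M 3 n s t) \<le> min_value (int n)"
proof -
  consider "n \<le> 3" | "4 \<le> n" "n \<le> 15" | "16 \<le> n" by linarith
  then show thesis
  proof cases
    case 1
    then have "mono_pairs n 1 1 = {}" by (auto simp: mono_pairs_def)
    moreover have "min_value (int n) = 0" using 1 assms by (intro min_value_eq_0) auto
    ultimately show ?thesis using that[of 1 1] assms by (simp add: schur_M_eq_card)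
  next
    case 2
    define s where "s = n div 4"
    have s: "1 \<le> s" "4 * s \<le> n" "n \<le> 4 * s + 3" "s \<le> 3" using 2 unfolding s_def by auto
    then have "int (schur_M 3 n s (4 * s)) \<le> tri_card (int s) + tri_card 0 + tri_card (int n - 4 * int s)"
      using schur_M_upper[of s "4 * s" n] by simp
    moreover have "int s \<in> {1, 2, 3}" "int n - 4 * int s \<in> {0, 1, 2, 3}" using s by auto
    then have "tri_card (int s) = 0" "tri_card (int n - 4 * int s) = 0" by (auto simp: tri_card_def)
    moreover have "tri_card 0 = 0" by (simp add: tri_card_def)
    moreover have "min_value (int n) = 0" using 2 by (intro min_value_eq_0) auto
    ultimately show ?thesis using that[of s "4 * s"] s by simp
  next
    case 3
    define k where "k = (int n - 16) div 54"
    define r where "r = int n - 54 * k"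
    define \<alpha> where "\<alpha> = (if r \<le> 43 then r - 4 else r - 6) div 4"
    have n: "int n = 54 * k + r" unfolding r_def by simp
    have k: "0 \<le> k" unfolding k_def using 3 by simp
    have "r = (int n - 16) mod 54 + 16"
      unfolding r_def k_def by (simp add: minus_mult_div_eq_mod[symmetric])
    then have r: "16 \<le> r" "r \<le> 69" using pos_mod_bound[of 54 "int n - 16"] by simp_all
    define s where "s = nat (12 * k + \<alpha>)"
    define t where "t = nat (4 * (12 * k + \<alpha>) + 3 * k + 3)"
    \<comment> \<open>The lower bound on the remainder gives \<open>t \<le> n\<close>, the upper
      bound 6 gives \<open>n \<le> 3 * t + 3\<close>.\<close>
    have \<alpha>: "1 \<le> \<alpha>" "0 \<le> r - 4 * \<alpha> - 3" "r - 4 * \<alpha> - 3 \<le> 6"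
      unfolding \<alpha>_def using r by (auto split: if_splits)
    have s: "int s = 12 * k + \<alpha>" and t: "int t = 51 * k + 4 * \<alpha> + 3"
      unfolding s_def t_def using k \<alpha> by auto
    define h where "h = k * (k - 1) div 2"
    have eqs: "int s = 3 * (4 * k) + \<alpha>" "int t - 4 * int s = 3 * k + 3"
      "int n - int t = 3 * k + (r - 4 * \<alpha> - 3)" unfolding s t n by simp_all
    have div: "4 * k * (4 * k - 1) div 2 = 8 * k\<^sup>2 - 2 * k" "2 * h = k * k - k"
      unfolding h_def by (simp_all add: power2_eq_square algebra_simps)
    have "int (schur_M 3 n s t) \<le> tri_card (int s) + tri_card (int t - 4 * int s) + tri_card (int n - int t)"
      using k \<alpha> s t n by (intro schur_M_upper) linarith+
    \<comment> \<open>The terms in \<open>k * \<alpha>\<close> from the first and third triangle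
      cancel, leaving the increment of \<open>min_value_shift\<close>.\<close>
    also have "\<dots> = tri_card \<alpha> + tri_card 3 + tri_card (r - 4 * \<alpha> - 3) + 27 * k\<^sup>2 - 9 * k + k * r"
      using div(2) unfolding eqs(2,3) unfolding eqs(1) tri_card_shift div(1) h_def[symmetric]
      by (simp add: power2_eq_square algebra_simps)
    also have "tri_card \<alpha> + tri_card 3 + tri_card (r - 4 * \<alpha> - 3) = min_value r"
      using sum_tri_card_eq_min_value[of r] r unfolding \<alpha>_def Let_def by simp
    also have "min_value r + 27 * k\<^sup>2 - 9 * k + k * r = min_value (int n)"
      unfolding n min_value_shift ..
    finally show ?thesis using that[of s t] k \<alpha> s t n by linarith
  qed
qed

theorem theorem4p3:
  fixes n :: nat
  assumes "n \<ge> 1"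
  shows "int (schur_M_min 3 n) =
           \<lfloor>(real n ^ 2 - 18 * real n + 101) / 108\<rfloor> +
           (if n mod 54 = 36 then 1
            else if n mod 54 = 30 \<or> n mod 54 = 42 then -1
            else 0)"
proof -
  let ?A = "{schur_M 3 n s t | s t. 1 \<le> s \<and> s \<le> t \<and> t \<le> n}"
  obtain s t where st: "1 \<le> s" "s \<le> t" "t \<le> n" "int (schur_M 3 n s t) \<le> min_value (int n)"
    using schur_M_le_min_value[OF assms] by blast
  have "Min ?A = schur_M 3 n s t"
  proof (rule Min_eqI)
    have "?A \<subseteq> (\<lambda>(s, t). schur_M 3 n s t) ` ({..n} \<times> {..n})" by auto
    then show "finite ?A" by (rule finite_subset) simp
    show "schur_M 3 n s t \<in> ?A" using st by blast
    fix y assume "y \<in> ?A"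
    then have "min_value (int n) \<le> int y" using min_value_le_schur_M by blast
    then show "schur_M 3 n s t \<le> y" using st by linarith
  qed
  then have "int (schur_M_min 3 n) = min_value (int n)"
    using st min_value_le_schur_M[of s t n] unfolding schur_M_min_def by simp
  moreover have "\<lfloor>(real n ^ 2 - 18 * real n + 101) / 108\<rfloor> = ((int n)\<^sup>2 - 18 * int n + 101) div 108"
    using floor_divide_of_int_eq[of "(int n)\<^sup>2 - 18 * int n + 101" 108, where ?'a = real] by simp
  moreover have "int n mod 54 = c \<longleftrightarrow> n mod 54 = nat c" if "0 \<le> c" for c
    using that nat_eq_iff[of c "n mod 54"] by (auto simp: zmod_int)
  ultimately show ?thesis by (simp add: min_value_def)
qed

end
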